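(* In $\mathbb{E}_2^4$, no $C^\infty$-special timelike Frenet curve is a (timelike) Bertrand curve.
   Context: $\mathbb{E}_2^4$ is $\mathbb{R}^4$ with the flat metric $g=-dx_1^2-dx_2^2+dx_3^2+dx_4^2$. A vector $\mathbf v$ is timelike if $g(\mathbf v,\mathbf v)<0$, and spacelike if $g(\mathbf v,\mathbf v)>0$ or $\mathbf v=0$. A curve is timelike if all its velocity vectors are timelike; a timelike curve $\mathbf c(s)$ is parametrized by arc length if $g(\mathbf c',\mathbf c')=-1$. A $C^\infty$-special timelike Frenet curve $C$ in $\mathbb{E}_2^4$ is a $C^\infty$ timelike curve $\mathbf c:L\to\mathbb{E}_2^4$ ($L$ an interval), parametrized by arc length $s$, with a $C^\infty$ moving frame $\{\mathbf t=\mathbf c',\mathbf n_1,\mathbf n_2,\mathbf n_3\}$ of mutually orthogonal vector fields along $C$ satisfying $g(\mathbf t,\mathbf t)=g(\mathbf n_1,\mathbf n_1)=-1$, $g(\mathbf n_2,\mathbf n_2)=g(\mathbf n_3,\mathbf n_3)=1$ (timelike principal normal, spacelike first and second binormals), and nowhere-zero $C^\infty$ functions $k_1,k_2,k_3$ on $L$ (the curvatures) such that $$\mathbf t'=-k_1\mathbf n_1,\quad \mathbf n_1'=k_1\mathbf t+k_2\mathbf n_2,\quad \mathbf n_2'=k_2\mathbf n_1+k_3\mathbf n_3,\quad \mathbf n_3'=-k_3\mathbf n_2 .$$ A $C^\infty$-special timelike Frenet curve $C$ ($\mathbf c:L\to\mathbb{E}_2^4$) is called a timelike Bertrand curve if there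 exist another $C^\infty$-special timelike Frenet curve $\bar C$ ($\bar{\mathbf c}:\bar L\to\mathbb{E}_2^4$), distinct from $C$, and a regular $C^\infty$ map $\varphi:L\to\bar L$, $\bar s=\varphi(s)$, with $\frac{d\varphi}{ds}(s)\neq 0$ for all $s\in L$, such that the two curves have the same 1-normal line at each pair of corresponding points $\mathbf c(s)$ and $\bar{\mathbf c}(\varphi(s))$. Here $s,\bar s$ are the arc length parameters of $C,\bar C$, and the 1-normal line of $C$ at $\mathbf c(s)$ is the affine line through $\mathbf c(s)$ in the direction $\mathbf n_1(s)$ (similarly for $\bar C$ with $\bar{\mathbf n}_1$). "Distinct from $C$" means that it is not the case that $\bar{\mathbf c}(\varphi(s))=\mathbf c(s)$ for all $s\in L$. *)

theory Defs
  imports "HOL-Analysis.Analysis"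
begin

text \<open>Flat metric of signature \<open>(-,-,+,+)\<close> on \<open>\<real>\<^sup>4\<close>.\<close>

definition metric :: "real^4 \<Rightarrow> real^4 \<Rightarrow> real" where
  "metric v w = - (v$1 * w$1) - v$2 * w$2 + v$3 * w$3 + v$4 * w$4"

definition timelike :: "real^4 \<Rightarrow> bool" where
  "timelike v \<longleftrightarrow> metric v v < 0"

text \<open>Derivatives are taken within the parameter set, so they are one-sided at an endpoint
  belonging to it. The empty and one-point sets are excluded: there \<open>at s within L\<close> is
  trivial and derivatives are not unique.\<close>

definition proper_interval :: "real set \<Rightarrow> bool" where
  "proper_interval L \<longleftrightarrow> is_interval L \<and> interior L \<noteq> {}"

definition vderiv_within :: "real set \<Rightarrow> (real \<Rightarrow> 'a::real_normed_vector) \<Rightarrow> real \<Rightarrow> 'a" where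
  "vderiv_within L f = (\<lambda>s. vector_derivative f (at s within L))"

text \<open>All iterated derivatives exist on \<open>L\<close>; intended for proper intervals only.\<close>

definition smooth_within :: "real set \<Rightarrow> (real \<Rightarrow> 'a::real_normed_vector) \<Rightarrow> bool" where
  "smooth_within L f \<longleftrightarrow> (\<forall>n. (vderiv_within L ^^ n) f differentiable_on L)"

definition timelike_curve :: "real set \<Rightarrow> (real \<Rightarrow> real^4) \<Rightarrow> bool" where
  "timelike_curve L c \<longleftrightarrow> (\<forall>s\<in>L. timelike (vderiv_within L c s))"

definition timelike_arc_length :: "real set \<Rightarrow> (real \<Rightarrow> real^4) \<Rightarrow> bool" where
  "timelike_arc_length L c \<longleftrightarrow>
     (\<forall>s\<in>L. metric (vderiv_within L c s) (vderiv_within L c s) = -1)"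

text \<open>A parametrized curve together with its normal fields and curvatures. Only the values
  on \<open>param_set\<close> are meaningful.\<close>

record framed_curve =
  param_set :: "real set"
  pos :: "real \<Rightarrow> real^4"
  normal1 :: "real \<Rightarrow> real^4"
  normal2 :: "real \<Rightarrow> real^4"
  normal3 :: "real \<Rightarrow> real^4"
  curv1 :: "real \<Rightarrow> real"
  curv2 :: "real \<Rightarrow> real"
  curv3 :: "real \<Rightarrow> real"

definition tangent :: "framed_curve \<Rightarrow> real \<Rightarrow> real^4" where
  "tangent C = vderiv_within (param_set C) (pos C)"

definition smooth_frame :: "framed_curve \<Rightarrow> bool" where
  "smooth_frame C \<longleftrightarrow>
     smooth_within (param_set C) (tangent C) \<and>
     smooth_within (param_set C) (normal1 C) \<and>
     smooth_within (param_set C) (normal2 C) \<and>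
     smooth_within (param_set C) (normal3 C)"

definition orthonormal_frame :: "framed_curve \<Rightarrow> bool" where
  "orthonormal_frame C \<longleftrightarrow> (\<forall>s\<in>param_set C.
     metric (tangent C s) (tangent C s) = -1 \<and>
     metric (normal1 C s) (normal1 C s) = -1 \<and>
     metric (normal2 C s) (normal2 C s) = 1 \<and>
     metric (normal3 C s) (normal3 C s) = 1 \<and>
     metric (tangent C s) (normal1 C s) = 0 \<and>
     metric (tangent C s) (normal2 C s) = 0 \<and>
     metric (tangent C s) (normal3 C s) = 0 \<and>
     metric (normal1 C s) (normal2 C s) = 0 \<and>
     metric (normal1 C s) (normal3 C s) = 0 \<and>
     metric (normal2 C s) (normal3 C s) = 0)"

definition smooth_nonzero_curvatures :: "framed_curve \<Rightarrow> bool" where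
  "smooth_nonzero_curvatures C \<longleftrightarrow>
     smooth_within (param_set C) (curv1 C) \<and>
     smooth_within (param_set C) (curv2 C) \<and>
     smooth_within (param_set C) (curv3 C) \<and>
     (\<forall>s\<in>param_set C. curv1 C s \<noteq> 0 \<and> curv2 C s \<noteq> 0 \<and> curv3 C s \<noteq> 0)"

definition frenet_equations :: "framed_curve \<Rightarrow> bool" where
  "frenet_equations C \<longleftrightarrow> (\<forall>s\<in>param_set C.
     (tangent C has_vector_derivative - (curv1 C s *\<^sub>R normal1 C s))
       (at s within param_set C) \<and>
     (normal1 C has_vector_derivative curv1 C s *\<^sub>R tangent C s + curv2 C s *\<^sub>R normal2 C s)
       (at s within param_set C) \<and>
     (normal2 C has_vector_derivative curv2 C s *\<^sub>R normal1 C s + curv3 C s *\<^sub>R normal3 C s)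
       (at s within param_set C) \<and>
     (normal3 C has_vector_derivative - (curv3 C s *\<^sub>R normal2 C s))
       (at s within param_set C))"

definition special_timelike_frenet_curve :: "framed_curve \<Rightarrow> bool" where
  "special_timelike_frenet_curve C \<longleftrightarrow>
     proper_interval (param_set C) \<and>
     smooth_within (param_set C) (pos C) \<and>
     timelike_curve (param_set C) (pos C) \<and>
     timelike_arc_length (param_set C) (pos C) \<and>
     smooth_frame C \<and>
     orthonormal_frame C \<and>
     smooth_nonzero_curvatures C \<and>
     frenet_equations C"

definition normal1_line :: "framed_curve \<Rightarrow> real \<Rightarrow> (real^4) set" where
  "normal1_line C s = {pos C s + r *\<^sub>R normal1 C s | r. True}"

text \<open>The map \<open>\<phi>\<close> need not be onto the parameter interval of \<open>C'\<close>. Distinctness of the two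
  curves is relative to \<open>\<phi>\<close>: corresponding points do not all coincide.\<close>

definition timelike_bertrand_curve :: "framed_curve \<Rightarrow> bool" where
  "timelike_bertrand_curve C \<longleftrightarrow>
     special_timelike_frenet_curve C \<and>
     (\<exists>C' (\<phi> :: real \<Rightarrow> real).
        special_timelike_frenet_curve C' \<and>
        \<phi> ` param_set C \<subseteq> param_set C' \<and>
        smooth_within (param_set C) \<phi> \<and>
        (\<forall>s\<in>param_set C. vderiv_within (param_set C) \<phi> s \<noteq> 0) \<and>
        \<not> (\<forall>s\<in>param_set C. pos C' (\<phi> s) = pos C s) \<and>
        (\<forall>s\<in>param_set C. normal1_line C' (\<phi> s) = normal1_line C s))"

end

theory Submission
  imports Defs
begin

text \<open>Let \<open>\<gamma>(s)\<close> be the point of the second curve corresponding to \<open>c(s)\<close>, so that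
  \<open>\<gamma> - c = a n\<^sub>1\<close>. Differentiating \<open>g(\<gamma> - c, n\<^sub>3) = 0\<close> shows that the second tangent is
  orthogonal to \<open>n\<^sub>3\<close>; its derivative is parallel to \<open>n\<^sub>1\<close>, so differentiating again and
  using \<open>k\<^sub>3 \<noteq> 0\<close> shows that it is orthogonal to \<open>n\<^sub>2\<close> as well. Differentiating
  \<open>g(\<gamma> - c, n\<^sub>2) = 0\<close> then gives \<open>a k\<^sub>2 = 0\<close>, whence \<open>a = 0\<close> and the curves coincide.\<close>

lemma bounded_bilinear_metric: "bounded_bilinear metric"
  unfolding bilinear_conv_bounded_bilinear[symmetric]
  by (auto simp: bilinear_def linear_iff metric_def algebra_simps)

interpretation metric: bounded_bilinear metric
  by (rule bounded_bilinear_metric)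

text \<open>A connected set with more than one point has no isolated points. This is what makes
  derivatives within \<open>L\<close> unique, even at an endpoint.\<close>

lemma at_within_proper_interval_neq_bot:
  assumes "proper_interval L" "s \<in> L"
  shows "at s within L \<noteq> bot"
proof -
  have "connected L" and ne: "interior L \<noteq> {}"
    using assms(1) by (auto simp: proper_interval_def is_interval_connected)
  have "L \<noteq> {s}"
    using ne by auto
  then have "s islimpt L"
    using \<open>connected L\<close> assms(2) by (intro connected_imp_perfect) auto
  then show ?thesis
    by (simp add: trivial_limit_within)
qed

lemma smooth_within_has_vector_derivative:
  assumes "smooth_within L f" "s \<in> L"
  shows "(f has_vector_derivative vderiv_within L f s) (at s within L)"
proof -
  have "(vderiv_within L ^^ 0) f differentiable_on L"
    using assms(1) unfolding smooth_within_def by blast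
  then show ?thesis
    using assms(2)
    by (simp add: differentiable_on_def vderiv_within_def vector_derivative_works)
qed

lemma has_vector_derivative_compose_within:
  assumes "(\<phi> has_vector_derivative d) (at s within L)"
    and "(f has_vector_derivative f') (at (\<phi> s) within M)"
    and "\<phi> ` L \<subseteq> M"
  shows "((\<lambda>x. f (\<phi> x)) has_vector_derivative d *\<^sub>R f') (at s within L)"
  using vector_diff_chain_within[OF assms(1) has_vector_derivative_within_subset[OF assms(2,3)]]
  by (simp add: o_def)

text \<open>The product rule and the constancy of the pairing on \<open>L\<close> give two
  derivatives of one function, which must agree.\<close>

lemma metric_eq_0_imp_derivative_eq_0:
  assumes "proper_interval L" "s \<in> L"
    and "(f has_vector_derivative f') (at s within L)"
    and "(h has_vector_derivative h') (at s within L)"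
    and "\<And>x. x \<in> L \<Longrightarrow> metric (f x) (h x) = 0"
  shows "metric (f s) h' + metric f' (h s) = 0"
proof -
  have "((\<lambda>x. metric (f x) (h x)) has_vector_derivative metric (f s) h' + metric f' (h s))
      (at s within L)"
    by (rule metric.has_vector_derivative[OF assms(3,4)])
  moreover have "((\<lambda>x. metric (f x) (h x)) has_vector_derivative 0) (at s within L)"
    by (rule has_vector_derivative_transform[OF assms(2) _ has_vector_derivative_const])
      (simp add: assms(5))
  ultimately show ?thesis
    by (rule vector_derivative_unique_within[OF at_within_proper_interval_neq_bot[OF assms(1,2)]])
qed

lemma normal1_line_eqE:
  assumes "normal1_line C' t = normal1_line C s"
  obtains a b where "pos C' t - pos C s = a *\<^sub>R normal1 C s" "normal1 C' t = b *\<^sub>R normal1 C s"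
proof -
  have "pos C' t + r *\<^sub>R normal1 C' t \<in> normal1_line C s" for r
    unfolding assms[symmetric] by (auto simp: normal1_line_def)
  \<comment> \<open>The points with parameters 0 and 1 on the line of \<open>C'\<close> differ by
    exactly its direction vector \<open>normal1 C' t\<close>.\<close>
  from this[of 0] this[of 1] obtain a d where ad: "pos C' t = pos C s + a *\<^sub>R normal1 C s"
      "pos C' t + normal1 C' t = pos C s + d *\<^sub>R normal1 C s"
    unfolding normal1_line_def scaleR_zero_left scaleR_one add_0_right by blast
  then have "normal1 C' t = (d - a) *\<^sub>R normal1 C s"
    by (simp add: algebra_simps)
  with ad(1) show thesis
    by (intro that[of a "d - a"]) auto
qed

text \<open>Coincidence at every parameter is what the distinctness clause of a Bertrand curve
  forbids.\<close>

lemma common_normal1_lines_imp_pos_eq: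
  assumes C: "special_timelike_frenet_curve C" and C': "special_timelike_frenet_curve C'"
    and \<phi>: "\<phi> ` param_set C \<subseteq> param_set C'" "smooth_within (param_set C) \<phi>"
      "\<And>s. s \<in> param_set C \<Longrightarrow> vderiv_within (param_set C) \<phi> s \<noteq> 0"
    and lines: "\<And>s. s \<in> param_set C \<Longrightarrow> normal1_line C' (\<phi> s) = normal1_line C s"
    and s: "s \<in> param_set C"
  shows "pos C' (\<phi> s) = pos C s"
proof -
  define L where "L = param_set C"
  define d where "d = vderiv_within L \<phi>"
  have L: "proper_interval L" and smooth: "smooth_within L (pos C)"
    and frame: "orthonormal_frame C" and curv: "smooth_nonzero_curvatures C"
    and fr: "frenet_equations C"
    using C by (auto simp: special_timelike_frenet_curve_def L_def)
  have smooth': "smooth_within (param_set C') (pos C')" and fr': "frenet_equations C'"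
    using C' by (auto simp: special_timelike_frenet_curve_def)
  define \<delta> where "\<delta> x = pos C' (\<phi> x) - pos C x" for x
  have dn: "d x \<noteq> 0" and k: "curv2 C x \<noteq> 0" "curv3 C x \<noteq> 0"
    and n2: "(normal2 C has_vector_derivative
        curv2 C x *\<^sub>R normal1 C x + curv3 C x *\<^sub>R normal3 C x) (at x within L)"
    and n3: "(normal3 C has_vector_derivative - (curv3 C x *\<^sub>R normal2 C x)) (at x within L)"
    and orth: "metric (normal1 C x) (normal1 C x) = -1"
      "metric (normal1 C x) (normal2 C x) = 0" "metric (normal1 C x) (normal3 C x) = 0"
      "metric (tangent C x) (normal2 C x) = 0" "metric (tangent C x) (normal3 C x) = 0"
    if "x \<in> L" for x
    using that \<phi>(3) curv fr frame
    unfolding d_def L_def smooth_nonzero_curvatures_def frenet_equations_def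
      orthonormal_frame_def
    by blast+
  have d\<phi>: "(\<phi> has_vector_derivative d x) (at x within L)" if "x \<in> L" for x
    using smooth_within_has_vector_derivative[OF \<phi>(2)] that by (simp add: L_def d_def)
  have in': "\<phi> x \<in> param_set C'" if "x \<in> L" for x
    using \<phi>(1) that by (auto simp: L_def)
  have d\<delta>: "(\<delta> has_vector_derivative d x *\<^sub>R tangent C' (\<phi> x) - tangent C x) (at x within L)"
    if x: "x \<in> L" for x
    unfolding \<delta>_def tangent_def
    using has_vector_derivative_compose_within[OF d\<phi>[OF x]
        smooth_within_has_vector_derivative[OF smooth' in'[OF x]] \<phi>(1)[folded L_def]]
      smooth_within_has_vector_derivative[OF smooth x]
    by (intro has_vector_derivative_diff) (simp_all add: L_def)
  \<comment> \<open>The Frenet equations of \<open>C'\<close> hold in its own arc length, so the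
    chain rule contributes the factor \<open>d x\<close>.\<close>
  have dt: "((\<lambda>x. tangent C' (\<phi> x)) has_vector_derivative
      d x *\<^sub>R - (curv1 C' (\<phi> x) *\<^sub>R normal1 C' (\<phi> x))) (at x within L)"
    if x: "x \<in> L" for x
    using fr' in'[OF x] \<phi>(1)
    by (intro has_vector_derivative_compose_within[OF d\<phi>[OF x]])
      (auto simp: frenet_equations_def L_def)
  \<comment> \<open>A shared line makes both vectors multiples of
    \<open>normal1 C x\<close>.\<close>
  have \<delta>n: "metric (\<delta> x) (normal2 C x) = 0" "metric (\<delta> x) (normal3 C x) = 0"
    and nn: "metric (normal1 C' (\<phi> x)) (normal3 C x) = 0" if x: "x \<in> L" for x
    using normal1_line_eqE[OF lines[OF x[unfolded L_def]]] orth[OF x]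
    by (metis \<delta>_def metric.scaleR_left scaleR_zero_right)+
  note metric_simps = metric.add_right metric.minus_right metric.minus_left metric.diff_left
    metric.scaleR_left metric.scaleR_right
  \<comment> \<open>The derivative of \<open>normal3 C\<close> is a multiple of
    \<open>normal2 C\<close>, so its pairing with \<open>\<delta>\<close> vanishes; what remains is
    \<open>d x\<close> times the claim.\<close>
  have t3: "metric (tangent C' (\<phi> x)) (normal3 C x) = 0" if x: "x \<in> L" for x
    using metric_eq_0_imp_derivative_eq_0[OF L x d\<delta>[OF x] n3[OF x] \<delta>n(2)]
      dn[OF x] \<delta>n[OF x] orth[OF x]
    by (simp add: metric_simps)
  have t2: "metric (tangent C' (\<phi> x)) (normal2 C x) = 0" if x: "x \<in> L" for x
    using metric_eq_0_imp_derivative_eq_0[OF L x dt[OF x] n3[OF x] t3] k[OF x] nn[OF x]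
    by (simp add: metric_simps)
  have x: "s \<in> L"
    using s by (simp add: L_def)
  \<comment> \<open>Both tangents are orthogonal to \<open>normal2 C s\<close>, and
    \<open>\<delta> s\<close> to \<open>normal3 C s\<close>; only the \<open>curv2\<close> term
    survives.\<close>
  have "metric (\<delta> s) (normal1 C s) = 0"
    using metric_eq_0_imp_derivative_eq_0[OF L x d\<delta>[OF x] n2[OF x] \<delta>n(1)]
      t2[OF x] k[OF x] \<delta>n[OF x] orth[OF x]
    by (simp add: metric_simps)
  moreover obtain a where "\<delta> s = a *\<^sub>R normal1 C s"
    using normal1_line_eqE[OF lines[OF s]] \<delta>_def by metis
  \<comment> \<open>Since \<open>normal1 C s\<close> is not null, pairing with it yields
    \<open>- a = 0\<close>.\<close>
  ultimately show ?thesis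
    using orth(1)[OF x] by (simp add: metric.scaleR_left \<delta>_def)
qed

theorem theorem3p3:
  fixes C :: framed_curve
  assumes "special_timelike_frenet_curve C"
  shows "\<not> timelike_bertrand_curve C"
  using common_normal1_lines_imp_pos_eq[OF assms] unfolding timelike_bertrand_curve_def by metis

end
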